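(* For all formulas $A,B$: $A\rhd_{\downarrow{\sf NNIL}({\sf par})}B$ if and only if $A\mathrel{|\!\sim_{{\sf NNIL}({\sf par})}}B$.
   Context: Language: $\wedge,\vee,\to,\bot$ over finite atoms ${\sf atom}={\sf var}\cup{\sf par}$ (disjoint variables and parameters); $\vdash$ is ${\sf IPC}$-derivability. Substitutions commute with connectives, fix $\bot$ and fix every parameter; $\theta$ is $A$-projective if $A\vdash a\leftrightarrow\theta(a)$ for all atoms $a$. ${\sf NNIL}$ is the least class containing atoms, $\bot,\top$, closed under $\wedge,\vee$, and containing $B\to C$ whenever $C\in{\sf NNIL}$ and $B$ is built from atoms, $\bot,\top$ by $\wedge,\vee$ only; ${\sf NNIL}({\sf par})$: those whose atoms are all parameters. $\downarrow{\sf NNIL}({\sf par})$ is the set of formulas $E$ for which there are an $E$-projective $\theta$ and $E'\in{\sf NNIL}({\sf par})$ with $\vdash\theta(E)\leftrightarrow E'$. Preservativity: $A\rhd_\Gamma B$ iff for every $E\in\Gamma$, $\vdash E\to A$ implies $\vdash E\to B$. Admissibility: $A\mathrel{|\!\sim_\Gamma}B$ iff for every substitution $\theta$ and every $C\in\Gamma$, $\vdash\theta(C\to A)$ implies $\vdash\theta(C\to B)$. *)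

theory Defs imports Main begin

datatype (atoms: 'a) form =
    Atom 'a
  | Bot  ("\<^bold>\<bottom>")
  | Conj "'a form" "'a form"  (infixr "\<^bold>\<and>" 55)
  | Disj "'a form" "'a form"  (infixr "\<^bold>\<or>" 54)
  | Impl "'a form" "'a form"  (infixr "\<^bold>\<rightarrow>" 53)

abbreviation Top :: "'a form"  ("\<^bold>\<top>") where
  "\<^bold>\<top> \<equiv> \<^bold>\<bottom> \<^bold>\<rightarrow> \<^bold>\<bottom>"

abbreviation Iff :: "'a form \<Rightarrow> 'a form \<Rightarrow> 'a form"  (infix "\<^bold>\<leftrightarrow>" 52) where
  "A \<^bold>\<leftrightarrow> B \<equiv> (A \<^bold>\<rightarrow> B) \<^bold>\<and> (B \<^bold>\<rightarrow> A)"

text \<open>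
  The variables and the parameters are two sets \<open>var\<close> and \<open>par\<close> inside a type \<open>'a\<close> of names,
  each of which may be empty; the formulas of the language are those whose atoms lie in their union.
\<close>

definition lang :: "'a set \<Rightarrow> 'a set \<Rightarrow> 'a form set" where
  "lang var par = {A. atoms A \<subseteq> var \<union> par}"

text \<open>Natural deduction for intuitionistic propositional logic, with sets of hypotheses.\<close>

inductive ipc :: "'a form set \<Rightarrow> 'a form \<Rightarrow> bool"  (infix "\<turnstile>" 50) where
  hyp:    "A \<in> H \<Longrightarrow> H \<turnstile> A"
| botE:   "H \<turnstile> \<^bold>\<bottom> \<Longrightarrow> H \<turnstile> A"
| conjI:  "H \<turnstile> A \<Longrightarrow> H \<turnstile> B \<Longrightarrow> H \<turnstile> A \<^bold>\<and> B"
| conjE1: "H \<turnstile> A \<^bold>\<and> B \<Longrightarrow> H \<turnstile> A"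
| conjE2: "H \<turnstile> A \<^bold>\<and> B \<Longrightarrow> H \<turnstile> B"
| disjI1: "H \<turnstile> A \<Longrightarrow> H \<turnstile> A \<^bold>\<or> B"
| disjI2: "H \<turnstile> B \<Longrightarrow> H \<turnstile> A \<^bold>\<or> B"
| disjE:  "H \<turnstile> A \<^bold>\<or> B \<Longrightarrow> insert A H \<turnstile> C \<Longrightarrow> insert B H \<turnstile> C \<Longrightarrow> H \<turnstile> C"
| implI:  "insert A H \<turnstile> B \<Longrightarrow> H \<turnstile> A \<^bold>\<rightarrow> B"
| implE:  "H \<turnstile> A \<^bold>\<rightarrow> B \<Longrightarrow> H \<turnstile> A \<Longrightarrow> H \<turnstile> B"

text \<open>
  A substitution is given by its values on atoms; \<open>subst\<close> is the induced map on formulas.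
  Only the values on \<open>var \<union> par\<close> matter, so nothing is required of other names.
\<close>

primrec subst :: "('a \<Rightarrow> 'a form) \<Rightarrow> 'a form \<Rightarrow> 'a form" where
  "subst \<theta> (Atom a) = \<theta> a"
| "subst \<theta> \<^bold>\<bottom> = \<^bold>\<bottom>"
| "subst \<theta> (A \<^bold>\<and> B) = subst \<theta> A \<^bold>\<and> subst \<theta> B"
| "subst \<theta> (A \<^bold>\<or> B) = subst \<theta> A \<^bold>\<or> subst \<theta> B"
| "subst \<theta> (A \<^bold>\<rightarrow> B) = subst \<theta> A \<^bold>\<rightarrow> subst \<theta> B"

definition substitution :: "'a set \<Rightarrow> 'a set \<Rightarrow> ('a \<Rightarrow> 'a form) \<Rightarrow> bool" where
  "substitution var par \<theta> \<longleftrightarrow>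
     (\<forall>x\<in>var. \<theta> x \<in> lang var par) \<and> (\<forall>p\<in>par. \<theta> p = Atom p)"

definition projective :: "'a set \<Rightarrow> 'a set \<Rightarrow> 'a form \<Rightarrow> ('a \<Rightarrow> 'a form) \<Rightarrow> bool" where
  "projective var par A \<theta> \<longleftrightarrow>
     substitution var par \<theta> \<and> (\<forall>a\<in>var \<union> par. {A} \<turnstile> Atom a \<^bold>\<leftrightarrow> subst \<theta> (Atom a))"

inductive_set NI :: "'a form set" where
  "Atom a \<in> NI"
| "\<^bold>\<bottom> \<in> NI"
| "\<^bold>\<top> \<in> NI"
| "A \<in> NI \<Longrightarrow> B \<in> NI \<Longrightarrow> A \<^bold>\<and> B \<in> NI"
| "A \<in> NI \<Longrightarrow> B \<in> NI \<Longrightarrow> A \<^bold>\<or> B \<in> NI"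

inductive_set NNIL :: "'a form set" where
  "Atom a \<in> NNIL"
| "\<^bold>\<bottom> \<in> NNIL"
| "\<^bold>\<top> \<in> NNIL"
| "A \<in> NNIL \<Longrightarrow> B \<in> NNIL \<Longrightarrow> A \<^bold>\<and> B \<in> NNIL"
| "A \<in> NNIL \<Longrightarrow> B \<in> NNIL \<Longrightarrow> A \<^bold>\<or> B \<in> NNIL"
| "B \<in> NI \<Longrightarrow> C \<in> NNIL \<Longrightarrow> B \<^bold>\<rightarrow> C \<in> NNIL"

definition NNIL_par :: "'a set \<Rightarrow> 'a form set" where
  "NNIL_par par = {A \<in> NNIL. atoms A \<subseteq> par}"

definition down :: "'a set \<Rightarrow> 'a set \<Rightarrow> 'a form set \<Rightarrow> 'a form set" where
  "down var par \<Gamma> =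
     {E \<in> lang var par. \<exists>\<theta>. projective var par E \<theta> \<and>
        (\<exists>E'\<in>\<Gamma>. {} \<turnstile> subst \<theta> E \<^bold>\<leftrightarrow> E')}"

definition preserves :: "'a form set \<Rightarrow> 'a form \<Rightarrow> 'a form \<Rightarrow> bool" where
  "preserves \<Gamma> A B \<longleftrightarrow> (\<forall>E\<in>\<Gamma>. {} \<turnstile> E \<^bold>\<rightarrow> A \<longrightarrow> {} \<turnstile> E \<^bold>\<rightarrow> B)"

definition admissible :: "'a set \<Rightarrow> 'a set \<Rightarrow> 'a form set \<Rightarrow> 'a form \<Rightarrow> 'a form \<Rightarrow> bool" where
  "admissible var par \<Gamma> A B \<longleftrightarrow>
     (\<forall>\<theta>. substitution var par \<theta> \<longrightarrow>
        (\<forall>C\<in>\<Gamma>. {} \<turnstile> subst \<theta> (C \<^bold>\<rightarrow> A) \<longrightarrow> {} \<turnstile> subst \<theta> (C \<^bold>\<rightarrow> B)))"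

end

theory Submission imports Defs begin

text \<open>
  The nontrivial direction is a relative form of Ghilardi's projective approximation. Suppose
  \<open>C\<close> is a formula in the parameters with \<open>C \<turnstile> \<theta>(A)\<close>, and let \<open>\<Phi>\<close> be finite, closed under
  subformulas, and contain \<open>A\<close>, \<open>C\<close> and all atoms. Worlds are prime theories \<open>w\<close>; the
  \<open>\<sigma>\<close>-type of \<open>w\<close> is \<open>{D \<in> \<Phi>. \<sigma>(D) \<in> w}\<close>. Let \<open>E\<close> say that every type above is the
  \<open>\<theta>\<close>-type of some world containing \<open>C\<close>; then \<open>E \<turnstile> A\<close>, \<open>E \<turnstile> C\<close> and \<open>C \<turnstile> \<theta>(E)\<close>. It remains to
  compose Ghilardi's substitutions to an \<open>E\<close>-projective \<open>\<sigma>\<close> with \<open>C \<turnstile> \<sigma>(E)\<close>. To a world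
  outside \<open>\<sigma>(E)\<close> assign the pair of its false parameters and the types occurring above it inside
  \<open>\<sigma>(E)\<close>. Where this pair is constant on the worlds above outside \<open>\<sigma>(E)\<close>, gluing a root below
  realizations of these types (an Aczel slash) yields a type which a single further substitution
  gives to all those worlds, putting them into \<open>E\<close>. Running through all types thus raises the
  minimal rank of such pairs, which is bounded; so finitely many rounds suffice. No
  well-foundedness of the worlds is needed.
\<close>

section \<open>Structural properties of derivability\<close>

lemma ipc_mono: "H \<turnstile> A \<Longrightarrow> H \<subseteq> K \<Longrightarrow> K \<turnstile> A"
proof (induction arbitrary: K rule: ipc.induct)
  case (disjE H A B C)
  then show ?case by (meson ipc.disjE insert_mono)
next
  case (implI A H B)
  then show ?case by (meson ipc.implI insert_mono)
qed (auto intro: ipc.intros)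

lemma ipc_cut: "H \<turnstile> A \<Longrightarrow> insert A H \<turnstile> B \<Longrightarrow> H \<turnstile> B"
  by (meson implE implI)

text \<open>Supplies the chain step of Zorn's lemma in \<open>prime_extension\<close>: a derivation
  from the union of a chain already lives in one member.\<close>

lemma ipc_finite: "H \<turnstile> A \<Longrightarrow> \<exists>F. finite F \<and> F \<subseteq> H \<and> F \<turnstile> A"
proof (induction rule: ipc.induct)
  case (hyp A H)
  then show ?case by (intro exI[of _ "{A}"]) (auto intro: ipc.hyp)
next
  case (botE H A)
  then show ?case by (meson ipc.botE)
next
  case (conjI H A B)
  then obtain F G where "finite F" "F \<subseteq> H" "F \<turnstile> A" "finite G" "G \<subseteq> H" "G \<turnstile> B" by blast
  then show ?case
    by (intro exI[of _ "F \<union> G"]) (auto intro: ipc.conjI ipc_mono)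
next
  case (conjE1 H A B)
  then show ?case by (meson ipc.conjE1)
next
  case (conjE2 H A B)
  then show ?case by (meson ipc.conjE2)
next
  case (disjI1 H A B)
  then show ?case by (meson ipc.disjI1)
next
  case (disjI2 H B A)
  then show ?case by (meson ipc.disjI2)
next
  case (disjE H A B C)
  then obtain F G K where *: "finite F" "F \<subseteq> H" "F \<turnstile> A \<^bold>\<or> B" "finite G" "G \<subseteq> insert A H" "G \<turnstile> C"
    "finite K" "K \<subseteq> insert B H" "K \<turnstile> C" by blast
  let ?L = "F \<union> (G - {A}) \<union> (K - {B})"
  have "?L \<turnstile> A \<^bold>\<or> B" "insert A ?L \<turnstile> C" "insert B ?L \<turnstile> C"
    by (rule ipc_mono[OF *(3)] ipc_mono[OF *(6)] ipc_mono[OF *(9)], blast)+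
  then have "?L \<turnstile> C" by (rule ipc.disjE)
  with * show ?case by (intro exI[of _ ?L]) auto
next
  case (implI A H B)
  then obtain G where *: "finite G" "G \<subseteq> insert A H" "G \<turnstile> B" by blast
  have "G - {A} \<turnstile> A \<^bold>\<rightarrow> B" by (rule ipc.implI, rule ipc_mono[OF *(3)]) blast
  with * show ?case by (intro exI[of _ "G - {A}"]) auto
next
  case (implE H A B)
  then obtain F G where "finite F" "F \<subseteq> H" "F \<turnstile> A \<^bold>\<rightarrow> B" "finite G" "G \<subseteq> H" "G \<turnstile> A" by blast
  then show ?case
    by (intro exI[of _ "F \<union> G"]) (auto intro: ipc.implE[of _ A] ipc_mono)
qed

section \<open>Prime theories: the worlds of the canonical Kripke model, ordered by
  inclusion\<close>

definition prime_theory :: "'a form set \<Rightarrow> bool" where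
  "prime_theory w \<longleftrightarrow> (\<forall>A. w \<turnstile> A \<longrightarrow> A \<in> w) \<and> \<^bold>\<bottom> \<notin> w
     \<and> (\<forall>A B. A \<^bold>\<or> B \<in> w \<longrightarrow> A \<in> w \<or> B \<in> w)"

lemma prime_theory_closed: "prime_theory w \<Longrightarrow> w \<turnstile> A \<Longrightarrow> A \<in> w"
  by (simp add: prime_theory_def)

text \<open>Zorn's lemma gives a set maximal among those not deriving \<open>D\<close>. Adding any
  further formula to it makes \<open>D\<close> derivable, so closure and primeness follow by cut and
  disjunction elimination.\<close>

lemma prime_extension:
  assumes "\<not> H \<turnstile> D"
  obtains w where "prime_theory w" "H \<subseteq> w" "D \<notin> w"
proof -
  let ?S = "{T. H \<subseteq> T \<and> \<not> T \<turnstile> D}"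
  have "\<exists>M\<in>?S. \<forall>X\<in>?S. M \<subseteq> X \<longrightarrow> X = M"
  proof (rule subset_Zorn_nonempty)
    show "?S \<noteq> {}" using assms by blast
    fix \<C> assume ne: "\<C> \<noteq> {}" and ch: "subset.chain ?S \<C>"
    have "\<not> \<Union>\<C> \<turnstile> D"
    proof
      assume "\<Union>\<C> \<turnstile> D"
      then obtain F where F: "finite F" "F \<subseteq> \<Union>\<C>" "F \<turnstile> D" using ipc_finite by blast
      then obtain T where "T \<in> \<C>" "F \<subseteq> T"
        using finite_subset_Union_chain[OF F(1,2) ne ch] by blast
      with F(3) ch show False by (auto simp: subset.chain_def dest: ipc_mono)
    qed
    with ne ch show "\<Union>\<C> \<in> ?S" by (fastforce simp: subset.chain_def)
  qed
  then obtain w where w: "H \<subseteq> w" "\<not> w \<turnstile> D" and max: "\<And>X. w \<subseteq> X \<Longrightarrow> \<not> X \<turnstile> D \<Longrightarrow> X = w"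
    by (auto 4 4)
  have ins: "insert A w \<turnstile> D" if "A \<notin> w" for A
    using that max[of "insert A w"] by blast
  have "prime_theory w"
    unfolding prime_theory_def
    using ins w(2) by (meson botE disjE hyp ipc_cut)
  moreover have "D \<notin> w" using w(2) hyp by blast
  ultimately show thesis using w(1) that by blast
qed

text \<open>Strong completeness for the canonical model; it lets later entailments be checked world
  by world.\<close>

lemma ipc_iff_prime: "H \<turnstile> D \<longleftrightarrow> (\<forall>w. prime_theory w \<longrightarrow> H \<subseteq> w \<longrightarrow> D \<in> w)"
  by (meson ipc_mono prime_extension prime_theory_closed)

text \<open>Membership obeys the Kripke forcing clauses. For implication, completeness turns the
  condition on larger worlds into a derivation from \<open>insert A w\<close>.\<close>

lemma prime_theory_simps [simp]:
  assumes "prime_theory w"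
  shows "\<^bold>\<bottom> \<notin> w"
    and "A \<^bold>\<and> B \<in> w \<longleftrightarrow> A \<in> w \<and> B \<in> w"
    and "A \<^bold>\<or> B \<in> w \<longleftrightarrow> A \<in> w \<or> B \<in> w"
    and "A \<^bold>\<rightarrow> B \<in> w \<longleftrightarrow> (\<forall>v. prime_theory v \<longrightarrow> w \<subseteq> v \<longrightarrow> A \<in> v \<longrightarrow> B \<in> v)"
proof -
  note c = prime_theory_closed[OF assms]
  show "\<^bold>\<bottom> \<notin> w" using assms by (simp add: prime_theory_def)
  show "A \<^bold>\<and> B \<in> w \<longleftrightarrow> A \<in> w \<and> B \<in> w" by (meson c conjE1 conjE2 conjI hyp)
  show "A \<^bold>\<or> B \<in> w \<longleftrightarrow> A \<in> w \<or> B \<in> w"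
    using assms by (meson prime_theory_def disjI1 disjI2 hyp)
  show "A \<^bold>\<rightarrow> B \<in> w \<longleftrightarrow> (\<forall>v. prime_theory v \<longrightarrow> w \<subseteq> v \<longrightarrow> A \<in> v \<longrightarrow> B \<in> v)"
  proof
    assume "A \<^bold>\<rightarrow> B \<in> w"
    then show "\<forall>v. prime_theory v \<longrightarrow> w \<subseteq> v \<longrightarrow> A \<in> v \<longrightarrow> B \<in> v"
      by (meson hyp implE prime_theory_closed subsetD)
  next
    assume "\<forall>v. prime_theory v \<longrightarrow> w \<subseteq> v \<longrightarrow> A \<in> v \<longrightarrow> B \<in> v"
    then have "insert A w \<turnstile> B" by (simp add: ipc_iff_prime)
    then show "A \<^bold>\<rightarrow> B \<in> w" by (intro c implI)
  qed
qed

lemma ipc_Impl_iff: "{} \<turnstile> A \<^bold>\<rightarrow> B \<longleftrightarrow> {A} \<turnstile> B"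
  by (auto simp: ipc_iff_prime)

section \<open>Substitutions at worlds and in derivations\<close>

lemma subst_Atom [simp]: "subst Atom D = D"
  by (induction D) auto

text \<open>Forcing at \<open>w\<close> depends only on the atoms at the worlds above
  \<open>w\<close>. The world is generalized in the induction because implication looks at all of
  these.\<close>

lemma subst_cong_prime:
  assumes "prime_theory w"
    and "\<And>v a. prime_theory v \<Longrightarrow> w \<subseteq> v \<Longrightarrow> a \<in> atoms D \<Longrightarrow> \<sigma> a \<in> v \<longleftrightarrow> \<tau> a \<in> v"
  shows "subst \<sigma> D \<in> w \<longleftrightarrow> subst \<tau> D \<in> w"
  using assms
proof (induction D arbitrary: w)
  case (Impl D1 D2)
  have "subst \<sigma> D1 \<in> v \<longleftrightarrow> subst \<tau> D1 \<in> v" "subst \<sigma> D2 \<in> v \<longleftrightarrow> subst \<tau> D2 \<in> v"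
    if "prime_theory v" "w \<subseteq> v" for v
    by (rule Impl.IH; use that Impl.prems(2) in \<open>force dest: order_trans\<close>)+
  then show ?case using Impl.prems(1) by auto
qed auto

lemma subst_fixed: "(\<And>a. a \<in> atoms D \<Longrightarrow> \<sigma> a = Atom a) \<Longrightarrow> subst \<sigma> D = D"
  by (induction D) auto

lemma subst_lang:
  "substitution var par \<sigma> \<Longrightarrow> D \<in> lang var par \<Longrightarrow> subst \<sigma> D \<in> lang var par"
  by (induction D) (auto simp: substitution_def lang_def)

lemma subst_ipc: "H \<turnstile> D \<Longrightarrow> subst \<sigma> ` H \<turnstile> subst \<sigma> D"
proof (induction rule: ipc.induct)
  case (disjE H A B C)
  then show ?case using ipc.disjE by auto
next
  case (implE H A B)
  then show ?case using ipc.implE by auto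
qed (auto intro: ipc.intros)

section \<open>Gluing a new root below given worlds\<close>

text \<open>The Aczel slash, with \<open>U\<close> in the role of the theories above a new root and \<open>P\<close> in the
  role of the atoms true at it.\<close>

primrec slash :: "'a form set set \<Rightarrow> 'a set \<Rightarrow> 'a form \<Rightarrow> bool" where
  "slash U P (Atom a) \<longleftrightarrow> a \<in> P"
| "slash U P \<^bold>\<bottom> \<longleftrightarrow> False"
| "slash U P (A \<^bold>\<and> B) \<longleftrightarrow> slash U P A \<and> slash U P B"
| "slash U P (A \<^bold>\<or> B) \<longleftrightarrow> slash U P A \<or> slash U P B"
| "slash U P (A \<^bold>\<rightarrow> B) \<longleftrightarrow> (\<forall>v\<in>U. A \<^bold>\<rightarrow> B \<in> v) \<and> (slash U P A \<longrightarrow> slash U P B)"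

lemma slash_member:
  assumes "\<And>v. v \<in> U \<Longrightarrow> prime_theory v" and "\<And>v. v \<in> U \<Longrightarrow> Atom ` P \<subseteq> v"
  shows "slash U P D \<Longrightarrow> v \<in> U \<Longrightarrow> D \<in> v"
  using assms by (induction D) auto

text \<open>The delicate case is implication introduction, because of the clause about
  \<open>U\<close>: slashed hypotheses belong to every member of \<open>U\<close>, hence so does the
  implication derived from them.\<close>

lemma slash_sound:
  assumes U: "\<And>v. v \<in> U \<Longrightarrow> prime_theory v" "\<And>v. v \<in> U \<Longrightarrow> Atom ` P \<subseteq> v"
  shows "H \<turnstile> D \<Longrightarrow> \<forall>h\<in>H. slash U P h \<Longrightarrow> slash U P D"
proof (induction rule: ipc.induct)
  case (implI A H B)
  have "A \<^bold>\<rightarrow> B \<in> v" if v: "v \<in> U" for v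
  proof -
    have "H \<subseteq> v" using implI.prems slash_member[OF U] v by blast
    moreover have "H \<turnstile> A \<^bold>\<rightarrow> B" by (rule ipc.implI) fact
    ultimately show ?thesis using U(1)[OF v] ipc_mono prime_theory_closed by blast
  qed
  then show ?case using implI by auto
qed auto

lemma prime_theory_slash:
  assumes U: "\<And>v. v \<in> U \<Longrightarrow> prime_theory v" "\<And>v. v \<in> U \<Longrightarrow> Atom ` P \<subseteq> v"
  shows "prime_theory {D. slash U P D}"
  unfolding prime_theory_def using slash_sound[OF U] by fastforce

section \<open>Formulas defining sets of types\<close>

lemma finite_conj:
  assumes "finite S"
  shows "\<exists>F. atoms F \<subseteq> \<Union>(atoms ` S) \<and>
    (\<forall>\<sigma> w. prime_theory w \<longrightarrow> (subst \<sigma> F \<in> w \<longleftrightarrow> (\<forall>D\<in>S. subst \<sigma> D \<in> w)))"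
  using assms
proof induction
  case empty
  show ?case by (rule exI[of _ "\<^bold>\<top>"]) simp
next
  case (insert D S)
  then obtain F where "atoms F \<subseteq> \<Union>(atoms ` S)"
    "\<forall>\<sigma> w. prime_theory w \<longrightarrow> (subst \<sigma> F \<in> w \<longleftrightarrow> (\<forall>D\<in>S. subst \<sigma> D \<in> w))" by blast
  then show ?case by (intro exI[of _ "D \<^bold>\<and> F"]) auto
qed

lemma finite_disj:
  assumes "finite S"
  shows "\<exists>F. atoms F \<subseteq> \<Union>(atoms ` S) \<and>
    (\<forall>\<sigma> w. prime_theory w \<longrightarrow> (subst \<sigma> F \<in> w \<longleftrightarrow> (\<exists>D\<in>S. subst \<sigma> D \<in> w)))"
  using assms
proof induction
  case empty
  show ?case by (rule exI[of _ "\<^bold>\<bottom>"]) simp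
next
  case (insert D S)
  then obtain F where "atoms F \<subseteq> \<Union>(atoms ` S)"
    "\<forall>\<sigma> w. prime_theory w \<longrightarrow> (subst \<sigma> F \<in> w \<longleftrightarrow> (\<exists>D\<in>S. subst \<sigma> D \<in> w))" by blast
  then show ?case by (intro exI[of _ "D \<^bold>\<or> F"]) auto
qed

definition type_at :: "'a form set \<Rightarrow> ('a \<Rightarrow> 'a form) \<Rightarrow> 'a form set \<Rightarrow> 'a form set" where
  "type_at \<Phi> \<sigma> w = {D \<in> \<Phi>. subst \<sigma> D \<in> w}"

text \<open>The implication from the conjunction of \<open>t\<close> to the disjunction of
  \<open>\<Phi> - t\<close> holds at a world iff no world above has type \<open>t\<close>.
  \<open>E\<close> conjoins these implications over all types outside \<open>R\<close>. They are
  chosen before \<open>\<sigma>\<close>, so one \<open>E\<close> serves all substitutions.\<close>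

lemma types_definable:
  assumes "finite \<Phi>" and "\<Phi> \<subseteq> lang var par"
  obtains E where "E \<in> lang var par"
    and "\<And>\<sigma> w. prime_theory w \<Longrightarrow>
      subst \<sigma> E \<in> w \<longleftrightarrow> (\<forall>v. prime_theory v \<longrightarrow> w \<subseteq> v \<longrightarrow> type_at \<Phi> \<sigma> v \<in> R)"
proof -
  have "\<exists>F. F \<in> lang var par \<and> (\<forall>\<sigma> w. prime_theory w \<longrightarrow>
      (subst \<sigma> F \<in> w \<longleftrightarrow> (\<forall>v. prime_theory v \<longrightarrow> w \<subseteq> v \<longrightarrow> type_at \<Phi> \<sigma> v \<noteq> t)))"
    if t: "t \<subseteq> \<Phi>" for t
  proof -
    have fin: "finite t" "finite (\<Phi> - t)" using t assms(1) finite_subset by auto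
    obtain F where F: "atoms F \<subseteq> \<Union>(atoms ` t)"
      "\<And>\<sigma> w. prime_theory w \<Longrightarrow> subst \<sigma> F \<in> w \<longleftrightarrow> (\<forall>D\<in>t. subst \<sigma> D \<in> w)"
      using finite_conj[OF fin(1)] by metis
    obtain G where G: "atoms G \<subseteq> \<Union>(atoms ` (\<Phi> - t))"
      "\<And>\<sigma> w. prime_theory w \<Longrightarrow> subst \<sigma> G \<in> w \<longleftrightarrow> (\<exists>D\<in>\<Phi> - t. subst \<sigma> D \<in> w)"
      using finite_disj[OF fin(2)] by metis
    have "F \<^bold>\<rightarrow> G \<in> lang var par"
      using F(1) G(1) assms(2) t unfolding lang_def by (auto; blast)
    moreover have "type_at \<Phi> \<sigma> v \<noteq> t \<longleftrightarrow> (subst \<sigma> F \<in> v \<longrightarrow> subst \<sigma> G \<in> v)"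
      if "prime_theory v" for \<sigma> v
      using t by (auto simp: F(2)[OF that] G(2)[OF that] type_at_def)
    ultimately show ?thesis by (intro exI[of _ "F \<^bold>\<rightarrow> G"]) simp
  qed
  then obtain f where f: "\<And>t. t \<subseteq> \<Phi> \<Longrightarrow> f t \<in> lang var par"
    "\<And>t \<sigma> w. t \<subseteq> \<Phi> \<Longrightarrow> prime_theory w \<Longrightarrow>
      subst \<sigma> (f t) \<in> w \<longleftrightarrow> (\<forall>v. prime_theory v \<longrightarrow> w \<subseteq> v \<longrightarrow> type_at \<Phi> \<sigma> v \<noteq> t)"
    by metis
  have "finite (f ` (Pow \<Phi> - R))" using assms(1) by simp
  from finite_conj[OF this] obtain E where
    E: "atoms E \<subseteq> \<Union>(atoms ` f ` (Pow \<Phi> - R))"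
      "\<And>\<sigma> w. prime_theory w \<Longrightarrow> subst \<sigma> E \<in> w \<longleftrightarrow> (\<forall>D\<in>f ` (Pow \<Phi> - R). subst \<sigma> D \<in> w)"
    by metis
  show thesis
  proof
    show "E \<in> lang var par" using E(1) f(1) unfolding lang_def by (auto; blast)
    fix \<sigma> w assume w: "prime_theory (w :: 'a form set)"
    have "subst \<sigma> E \<in> w \<longleftrightarrow>
        (\<forall>t\<in>Pow \<Phi> - R. \<forall>v. prime_theory v \<longrightarrow> w \<subseteq> v \<longrightarrow> type_at \<Phi> \<sigma> v \<noteq> t)"
      using E(2)[OF w] f(2)[OF _ w] by auto
    moreover have "type_at \<Phi> \<sigma> v \<in> Pow \<Phi>" for v by (auto simp: type_at_def)
    ultimately show "subst \<sigma> E \<in> w \<longleftrightarrow>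
        (\<forall>v. prime_theory v \<longrightarrow> w \<subseteq> v \<longrightarrow> type_at \<Phi> \<sigma> v \<in> R)" by blast
  qed
qed

section \<open>The setting of relative unification\<close>

locale relative_unifier =
  fixes var par :: "'a set" and C :: "'a form" and \<theta> :: "'a \<Rightarrow> 'a form"
    and \<Phi> :: "'a form set" and E :: "'a form"
  assumes finite_par: "finite par" and disjoint: "var \<inter> par = {}"
    and C_par: "atoms C \<subseteq> par" and C_in: "C \<in> \<Phi>"
    and theta: "substitution var par \<theta>"
    and finite_Phi: "finite \<Phi>" and Phi_lang: "\<Phi> \<subseteq> lang var par"
    and Atom_Phi: "Atom ` (var \<union> par) \<subseteq> \<Phi>"
    and Conj_Phi: "\<And>D D'. D \<^bold>\<and> D' \<in> \<Phi> \<Longrightarrow> D \<in> \<Phi> \<and> D' \<in> \<Phi>"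
    and Disj_Phi: "\<And>D D'. D \<^bold>\<or> D' \<in> \<Phi> \<Longrightarrow> D \<in> \<Phi> \<and> D' \<in> \<Phi>"
    and Impl_Phi: "\<And>D D'. D \<^bold>\<rightarrow> D' \<in> \<Phi> \<Longrightarrow> D \<in> \<Phi> \<and> D' \<in> \<Phi>"
    and E_lang: "E \<in> lang var par"
    and E_iff: "\<And>\<sigma> w. prime_theory w \<Longrightarrow> subst \<sigma> E \<in> w \<longleftrightarrow>
      (\<forall>v. prime_theory v \<longrightarrow> w \<subseteq> v \<longrightarrow>
        type_at \<Phi> \<sigma> v \<in> {type_at \<Phi> \<theta> u | u. prime_theory u \<and> C \<in> u})"
begin

definition realized :: "'a form set set" where
  "realized = {type_at \<Phi> \<theta> u | u. prime_theory u \<and> C \<in> u}"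

lemma subst_E_iff:
  "prime_theory w \<Longrightarrow>
    subst \<sigma> E \<in> w \<longleftrightarrow> (\<forall>v. prime_theory v \<longrightarrow> w \<subseteq> v \<longrightarrow> type_at \<Phi> \<sigma> v \<in> realized)"
  unfolding realized_def by (rule E_iff)

lemma subst_par: "substitution var par \<sigma> \<Longrightarrow> atoms D \<subseteq> par \<Longrightarrow> subst \<sigma> D = D"
  by (rule subst_fixed) (auto simp: substitution_def)

lemma subst_theta_E: "{C} \<turnstile> subst \<theta> E"
  unfolding ipc_iff_prime by (auto simp: subst_E_iff realized_def)

text \<open>Under the identity substitution, a world containing \<open>E\<close> has the
  \<open>\<theta>\<close>-type of some world containing \<open>C\<close>, and
  \<open>subst \<theta> D\<close> holds at the latter.\<close>

lemma E_entails:
  assumes "D \<in> \<Phi>" "{C} \<turnstile> subst \<theta> D"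
  shows "{E} \<turnstile> D"
  unfolding ipc_iff_prime
proof (intro allI impI)
  fix w assume w: "prime_theory w" "{E} \<subseteq> w"
  then obtain u where u: "prime_theory u" "C \<in> u" "type_at \<Phi> Atom w = type_at \<Phi> \<theta> u"
    using subst_E_iff[of w Atom] by (auto simp: realized_def)
  then have "subst \<theta> D \<in> u" using assms(2) by (auto simp: ipc_iff_prime)
  with u(3) assms(1) show "D \<in> w" by (auto simp: type_at_def)
qed

lemma E_entails_C: "{E} \<turnstile> C"
  by (rule E_entails) (simp_all add: C_in subst_par[OF theta C_par] hyp)

section \<open>Ghilardi's substitutions and their projectivity\<close>

text \<open>Composes \<open>\<sigma>\<close> with Ghilardi's substitution for \<open>E\<close>: nothing changes where \<open>\<sigma> E\<close> holds, and
  elsewhere the variables are made true exactly when they are in \<open>t\<close>, as far as persistence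
  allows.\<close>

definition update :: "'a form set \<Rightarrow> ('a \<Rightarrow> 'a form) \<Rightarrow> 'a \<Rightarrow> 'a form" where
  "update t \<sigma> x = (if x \<in> var
     then if Atom x \<in> t then subst \<sigma> E \<^bold>\<rightarrow> \<sigma> x else subst \<sigma> E \<^bold>\<and> \<sigma> x
     else Atom x)"

inductive_set updates :: "('a \<Rightarrow> 'a form) set" where
  "Atom \<in> updates"
| "\<sigma> \<in> updates \<Longrightarrow> update t \<sigma> \<in> updates"

lemma updates_substitution: "\<sigma> \<in> updates \<Longrightarrow> substitution var par \<sigma>"
proof (induction rule: updates.induct)
  case 1
  show ?case by (auto simp: substitution_def lang_def)
next
  case (2 \<sigma> t)
  then have "subst \<sigma> E \<in> lang var par" using subst_lang E_lang by blast
  with 2 disjoint show ?case by (auto simp: substitution_def lang_def update_def)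
qed

text \<open>Where \<open>subst \<sigma> E\<close> holds, both the implication and the conjunction
  assigned to a variable are equivalent to its old value, and this persists at larger
  worlds.\<close>

lemma subst_update:
  assumes \<sigma>: "\<sigma> \<in> updates" and w: "prime_theory w" "subst \<sigma> E \<in> w" and D: "D \<in> lang var par"
  shows "subst (update t \<sigma>) D \<in> w \<longleftrightarrow> subst \<sigma> D \<in> w"
proof (rule subst_cong_prime[OF w(1)])
  fix v a assume v: "prime_theory v" "w \<subseteq> v" and a: "a \<in> atoms D"
  show "update t \<sigma> a \<in> v \<longleftrightarrow> \<sigma> a \<in> v"
  proof (cases "a \<in> var")
    case True
    have "subst \<sigma> E \<in> v" using v w by blast
    with True v(1) show ?thesis by (auto simp: update_def)
  next
    case False
    then have "a \<in> par" using a D by (auto simp: lang_def)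
    with False updates_substitution[OF \<sigma>] show ?thesis
      by (simp add: update_def substitution_def)
  qed
qed

lemma updates_E:
  assumes "\<sigma> \<in> updates" "prime_theory w" "E \<in> w" "D \<in> lang var par"
  shows "subst \<sigma> D \<in> w \<longleftrightarrow> D \<in> w"
  using assms(1,4)
proof (induction arbitrary: D rule: updates.induct)
  case (2 \<sigma> t)
  \<comment> \<open>The induction hypothesis is used twice: for \<open>E\<close>, to see that
    \<open>subst \<sigma> E\<close> holds at \<open>w\<close>, and for \<open>D\<close>.\<close>
  then show ?case using subst_update[of \<sigma> w D t] assms(2,3) E_lang by blast
qed simp

lemma updates_projective:
  assumes "\<sigma> \<in> updates"
  shows "projective var par E \<sigma>"
proof -
  have "{E} \<turnstile> Atom a \<^bold>\<leftrightarrow> subst \<sigma> (Atom a)" if "a \<in> var \<union> par" for a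
    using updates_E[OF assms, of _ "Atom a"] that
    by (auto simp: ipc_iff_prime lang_def)
  then show ?thesis using updates_substitution[OF assms] by (simp add: projective_def)
qed

section \<open>The rank of a world\<close>

definition types_above :: "('a \<Rightarrow> 'a form) \<Rightarrow> 'a form set \<Rightarrow> 'a form set set" where
  "types_above \<sigma> w = {type_at \<Phi> \<sigma> v | v. prime_theory v \<and> w \<subseteq> v \<and> subst \<sigma> E \<in> v}"

definition false_pars :: "'a form set \<Rightarrow> 'a set" where
  "false_pars w = {q \<in> par. Atom q \<notin> w}"

text \<open>A lexicographic code of the pair: the weight exceeds every possible number of
  types.\<close>

definition rank :: "('a \<Rightarrow> 'a form) \<Rightarrow> 'a form set \<Rightarrow> nat" where
  "rank \<sigma> w = card (false_pars w) * Suc (card (Pow \<Phi>)) + card (types_above \<sigma> w)"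

lemma types_above_Pow: "types_above \<sigma> w \<subseteq> Pow \<Phi>"
  by (auto simp: types_above_def type_at_def)

lemma finite_types_above [simp]: "finite (types_above \<sigma> w)"
  by (rule finite_subset[OF types_above_Pow]) (simp add: finite_Phi)

lemma card_types_above: "card (types_above \<sigma> w) \<le> card (Pow \<Phi>)"
  by (rule card_mono[OF _ types_above_Pow]) (simp add: finite_Phi)

lemma finite_false_pars [simp]: "finite (false_pars w)"
  using finite_par by (simp add: false_pars_def)

lemma rank_le: "rank \<sigma> w \<le> card par * Suc (card (Pow \<Phi>)) + card (Pow \<Phi>)"
  unfolding rank_def
  by (intro add_mono mult_right_mono card_types_above card_mono finite_par)
    (auto simp: false_pars_def)

lemma types_above_antimono: "w \<subseteq> v \<Longrightarrow> types_above \<sigma> v \<subseteq> types_above \<sigma> w"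
  by (auto simp: types_above_def)

text \<open>Both components shrink as the world grows, so a rank that does not drop forces both to
  stay the same.\<close>

lemma rank_eqD:
  assumes "w \<subseteq> v" "rank \<sigma> w \<le> rank \<sigma> v"
  shows "types_above \<sigma> v = types_above \<sigma> w" "false_pars v = false_pars w"
proof -
  have sub: "false_pars v \<subseteq> false_pars w" using assms(1) by (auto simp: false_pars_def)
  show eq: "false_pars v = false_pars w"
  proof (rule ccontr)
    assume "false_pars v \<noteq> false_pars w"
    with sub have "Suc (card (false_pars v)) \<le> card (false_pars w)"
      by (simp add: psubset_card_mono Suc_leI psubset_eq)
    \<comment> \<open>One lost parameter costs more than the types above \<open>v\<close> can make
      up.\<close>
    then have "Suc (card (false_pars v)) * Suc (card (Pow \<Phi>))
        \<le> card (false_pars w) * Suc (card (Pow \<Phi>))"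
      by (rule mult_right_mono) simp
    with assms(2) card_types_above[of \<sigma> v] show False by (simp add: rank_def)
  qed
  show "types_above \<sigma> v = types_above \<sigma> w"
    using assms(2) eq types_above_antimono[OF assms(1)]
    by (intro card_seteq) (auto simp: rank_def)
qed

lemma subst_update_E:
  "\<sigma> \<in> updates \<Longrightarrow> prime_theory w \<Longrightarrow> subst \<sigma> E \<in> w \<Longrightarrow> subst (update t \<sigma>) E \<in> w"
  using subst_update E_lang by blast

lemma type_at_update:
  "\<sigma> \<in> updates \<Longrightarrow> prime_theory w \<Longrightarrow> subst \<sigma> E \<in> w \<Longrightarrow>
    type_at \<Phi> (update t \<sigma>) w = type_at \<Phi> \<sigma> w"
  using subst_update Phi_lang unfolding type_at_def by blast

text \<open>A world inside \<open>subst \<sigma> E\<close> stays inside and keeps its type, so an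
  update can only add types.\<close>

lemma types_above_update:
  assumes "\<sigma> \<in> updates"
  shows "types_above \<sigma> w \<subseteq> types_above (update t \<sigma>) w"
proof
  fix s assume "s \<in> types_above \<sigma> w"
  then obtain v where v: "s = type_at \<Phi> \<sigma> v" "prime_theory v" "w \<subseteq> v" "subst \<sigma> E \<in> v"
    by (auto simp: types_above_def)
  then have "s = type_at \<Phi> (update t \<sigma>) v" "subst (update t \<sigma>) E \<in> v"
    using type_at_update subst_update_E assms by auto
  with v show "s \<in> types_above (update t \<sigma>) w" by (auto simp: types_above_def)
qed

lemma rank_update: "\<sigma> \<in> updates \<Longrightarrow> rank \<sigma> w \<le> rank (update t \<sigma>) w"
  unfolding rank_def by (intro add_left_mono card_mono types_above_update) auto

text \<open>Reads off from the set of types alone the part of the forcing clause for implication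
  that concerns worlds inside \<open>subst \<sigma> E\<close>. This works because that region is
  upward closed.\<close>

lemma types_above_Impl:
  assumes w: "prime_theory w" and D: "D \<^bold>\<rightarrow> D' \<in> \<Phi>"
  shows "(\<forall>s\<in>types_above \<sigma> w. D \<^bold>\<rightarrow> D' \<in> s) \<longleftrightarrow>
    (\<forall>v. prime_theory v \<longrightarrow> w \<subseteq> v \<longrightarrow> subst \<sigma> E \<in> v \<longrightarrow> subst \<sigma> D \<in> v \<longrightarrow> subst \<sigma> D' \<in> v)"
proof -
  have "D \<^bold>\<rightarrow> D' \<in> type_at \<Phi> \<sigma> v \<longleftrightarrow> subst \<sigma> (D \<^bold>\<rightarrow> D') \<in> v" for v
    using D by (simp add: type_at_def del: subst.simps)
  then have "(\<forall>s\<in>types_above \<sigma> w. D \<^bold>\<rightarrow> D' \<in> s) \<longleftrightarrow>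
    (\<forall>v. prime_theory v \<longrightarrow> w \<subseteq> v \<longrightarrow> subst \<sigma> E \<in> v \<longrightarrow> subst \<sigma> (D \<^bold>\<rightarrow> D') \<in> v)"
    unfolding types_above_def by blast
  also have "\<dots> \<longleftrightarrow>
    (\<forall>v. prime_theory v \<longrightarrow> w \<subseteq> v \<longrightarrow> subst \<sigma> E \<in> v \<longrightarrow> subst \<sigma> D \<in> v \<longrightarrow> subst \<sigma> D' \<in> v)"
    by (auto; blast)
  finally show ?thesis .
qed

section \<open>Root types and flat worlds\<close>

text \<open>Says that \<open>t\<close> is the type of a root glued below points with the types in \<open>\<rho>\<close>, where the
  parameters in \<open>F\<close> are false.\<close>

definition root_type :: "'a form set set \<Rightarrow> 'a set \<Rightarrow> 'a form set \<Rightarrow> bool" where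
  "root_type \<rho> F t \<longleftrightarrow> t \<in> realized \<and> (\<forall>s\<in>\<rho>. t \<subseteq> s) \<and> (\<forall>q\<in>par. Atom q \<in> t \<longleftrightarrow> q \<notin> F) \<and>
     (\<forall>D D'. D \<^bold>\<rightarrow> D' \<in> \<Phi> \<longrightarrow>
       (D \<^bold>\<rightarrow> D' \<in> t \<longleftrightarrow> (\<forall>s\<in>\<rho>. D \<^bold>\<rightarrow> D' \<in> s) \<and> (D \<in> t \<longrightarrow> D' \<in> t)))"

definition flat :: "('a \<Rightarrow> 'a form) \<Rightarrow> 'a form set \<Rightarrow> bool" where
  "flat \<sigma> w \<longleftrightarrow> prime_theory w \<and> C \<in> w \<and> subst \<sigma> E \<notin> w \<and>
     (\<forall>v. prime_theory v \<longrightarrow> w \<subseteq> v \<longrightarrow> subst \<sigma> E \<notin> v \<longrightarrow>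
       types_above \<sigma> v = types_above \<sigma> w \<and> false_pars v = false_pars w)"

lemma flat_upward:
  assumes "flat \<sigma> w" "prime_theory v" "w \<subseteq> v" "subst \<sigma> E \<notin> v"
  shows "flat \<sigma> v"
    and "types_above \<sigma> v = types_above \<sigma> w" and "false_pars v = false_pars w"
proof -
  note * = assms(1)[unfolded flat_def]
  show eq: "types_above \<sigma> v = types_above \<sigma> w" "false_pars v = false_pars w"
    using * assms(2-4) by blast+
  have "types_above \<sigma> v' = types_above \<sigma> w \<and> false_pars v' = false_pars w"
    if "prime_theory v'" "v \<subseteq> v'" "subst \<sigma> E \<notin> v'" for v'
    using * that assms(3) order_trans by blast
  moreover have "C \<in> v" using * assms(3) by blast
  ultimately show "flat \<sigma> v"
    using assms(2,4) eq unfolding flat_def by metis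
qed

text \<open>Glue a root below worlds realizing the types above \<open>w\<close>. The slash clause
  for implication becomes the one in \<open>root_type\<close>; the crux is that \<open>C\<close>
  holds at the root, so that its type is realized.\<close>

lemma root_type_exists:
  assumes \<sigma>: "\<sigma> \<in> updates" and fl: "flat \<sigma> w"
  shows "\<exists>t. root_type (types_above \<sigma> w) (false_pars w) t"
proof -
  have w: "prime_theory w" "C \<in> w" "subst \<sigma> E \<notin> w" using fl by (auto simp: flat_def)
  have fix_par: "subst \<sigma> D = D" "subst \<theta> D = D" if "atoms D \<subseteq> par" for D
    using that subst_par theta updates_substitution[OF \<sigma>] by auto
  let ?\<rho> = "types_above \<sigma> w"
  \<comment> \<open>A type above \<open>w\<close> occurs where \<open>subst \<sigma> E\<close>
    holds, hence is the \<open>\<theta>\<close>-type of a world containing \<open>C\<close>.\<close>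
  have "\<exists>u. prime_theory u \<and> C \<in> u \<and> s = type_at \<Phi> \<theta> u" if "s \<in> ?\<rho>" for s
    using that subst_E_iff[of _ \<sigma>] by (fastforce simp: types_above_def realized_def)
  then obtain u where u: "\<And>s. s \<in> ?\<rho> \<Longrightarrow> prime_theory (u s) \<and> C \<in> u s \<and> s = type_at \<Phi> \<theta> (u s)"
    by metis
  have mem: "D \<in> s \<longleftrightarrow> subst \<theta> D \<in> u s" if "s \<in> ?\<rho>" "D \<in> \<Phi>" for s D
    using u[OF that(1)] that(2) by (auto simp: type_at_def)
  define P where "P = par - false_pars w"
  \<comment> \<open>Both substitutions fix parameters, so a parameter true at \<open>w\<close>
    passes through the shared type \<open>s\<close> to \<open>u s\<close>.\<close>
  have P: "Atom ` P \<subseteq> u s" if s: "s \<in> ?\<rho>" for s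
  proof (intro subsetI, elim imageE)
    fix x q assume q: "x = Atom q" "q \<in> P"
    obtain v where v: "s = type_at \<Phi> \<sigma> v" "w \<subseteq> v" using s by (auto simp: types_above_def)
    have "Atom q \<in> \<Phi>" "subst \<sigma> (Atom q) \<in> v"
      using q v(2) Atom_Phi fix_par(1)[of "Atom q"] by (auto simp: P_def false_pars_def)
    with v have "Atom q \<in> s" by (simp add: type_at_def)
    then show "x \<in> u s"
      using mem[OF s \<open>Atom q \<in> \<Phi>\<close>] fix_par(2)[of "Atom q"] q by (auto simp: P_def)
  qed
  let ?U = "u ` ?\<rho>"
  define r where "r = {D. slash ?U P D}"
  have U: "\<And>v. v \<in> ?U \<Longrightarrow> prime_theory v" "\<And>v. v \<in> ?U \<Longrightarrow> Atom ` P \<subseteq> v"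
    using u P by auto
  have r: "prime_theory r" unfolding r_def by (rule prime_theory_slash[OF U])
  have below: "D \<in> u s" if "D \<in> r" "s \<in> ?\<rho>" for D s
    using slash_member[OF U] that by (auto simp: r_def)
  have Impl_r: "D \<^bold>\<rightarrow> D' \<in> r \<longleftrightarrow> (\<forall>s\<in>?\<rho>. D \<^bold>\<rightarrow> D' \<in> u s) \<and> (D \<in> r \<longrightarrow> D' \<in> r)" for D D'
    by (simp add: r_def)
  \<comment> \<open>Parameter formulas in \<open>\<Phi>\<close> cannot tell the root from the worlds
    above \<open>w\<close> outside \<open>subst \<sigma> E\<close>. For implication, larger worlds
    inside that region are covered by the types, those outside by the induction hypothesis.\<close>
  have "D \<in> v \<longleftrightarrow> D \<in> r"
    if "D \<in> \<Phi>" "atoms D \<subseteq> par" "prime_theory v" "w \<subseteq> v" "subst \<sigma> E \<notin> v" for D v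
    using that
  proof (induction D arbitrary: v)
    case (Atom q)
    then show ?case using flat_upward(3)[OF fl Atom(3-5)]
      by (auto simp: r_def P_def false_pars_def)
  next
    case Bot
    then show ?case using r by simp
  next
    case (Conj D1 D2)
    then show ?case using r Conj_Phi[of D1 D2] by simp
  next
    case (Disj D1 D2)
    then show ?case using r Disj_Phi[of D1 D2] by simp
  next
    case (Impl D1 D2)
    note v = \<open>prime_theory v\<close> \<open>w \<subseteq> v\<close> \<open>subst \<sigma> E \<notin> v\<close>
    have IH: "D1 \<in> v' \<longleftrightarrow> D1 \<in> r" "D2 \<in> v' \<longleftrightarrow> D2 \<in> r"
      if "prime_theory v'" "v \<subseteq> v'" "subst \<sigma> E \<notin> v'" for v'
      using Impl.IH[of v'] that Impl_Phi[of D1 D2] Impl.prems by auto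
    have "subst \<sigma> D1 = D1" "subst \<sigma> D2 = D2" using fix_par(1) Impl.prems(2) by auto
    then have "(\<forall>s\<in>types_above \<sigma> v. D1 \<^bold>\<rightarrow> D2 \<in> s) \<longleftrightarrow>
        (\<forall>v'. prime_theory v' \<longrightarrow> v \<subseteq> v' \<longrightarrow> subst \<sigma> E \<in> v' \<longrightarrow> D1 \<in> v' \<longrightarrow> D2 \<in> v')"
      using types_above_Impl[OF v(1) Impl.prems(1), of \<sigma>] by simp
    then have "D1 \<^bold>\<rightarrow> D2 \<in> v \<longleftrightarrow> (\<forall>s\<in>types_above \<sigma> v. D1 \<^bold>\<rightarrow> D2 \<in> s) \<and> (D1 \<in> r \<longrightarrow> D2 \<in> r)"
      using v IH by (auto; blast)
    also have "types_above \<sigma> v = ?\<rho>" by (rule flat_upward(2)[OF fl v])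
    also have "(\<forall>s\<in>?\<rho>. D1 \<^bold>\<rightarrow> D2 \<in> s) \<longleftrightarrow> (\<forall>s\<in>?\<rho>. D1 \<^bold>\<rightarrow> D2 \<in> u s)"
      using mem[OF _ Impl.prems(1)] fix_par(2)[OF Impl.prems(2)] by simp
    finally show ?case by (simp only: Impl_r)
  qed
  then have "C \<in> r" using w C_in C_par by blast
  let ?t = "type_at \<Phi> \<theta> r"
  have "root_type ?\<rho> (false_pars w) ?t"
    unfolding root_type_def
  proof (intro HOL.conjI allI ballI impI)
    show "?t \<in> realized" using r \<open>C \<in> r\<close> by (auto simp: realized_def)
    show "?t \<subseteq> s" if "s \<in> ?\<rho>" for s
      using below[OF _ that] mem[OF that] by (auto simp: type_at_def)
    show "Atom q \<in> ?t \<longleftrightarrow> q \<notin> false_pars w" if "q \<in> par" for q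
      using that Atom_Phi fix_par(2)[of "Atom q"] by (auto simp: type_at_def r_def P_def)
    show "D \<^bold>\<rightarrow> D' \<in> ?t \<longleftrightarrow> (\<forall>s\<in>?\<rho>. D \<^bold>\<rightarrow> D' \<in> s) \<and> (D \<in> ?t \<longrightarrow> D' \<in> ?t)"
      if D: "D \<^bold>\<rightarrow> D' \<in> \<Phi>" for D D'
    proof -
      have "D \<^bold>\<rightarrow> D' \<in> ?t \<longleftrightarrow> subst \<theta> D \<^bold>\<rightarrow> subst \<theta> D' \<in> r"
        unfolding type_at_def using D by (simp only: mem_Collect_eq subst.simps simp_thms)
      with mem[OF _ D] Impl_Phi[OF D] show ?thesis
        unfolding Impl_r by (simp add: type_at_def)
    qed
  qed
  then show ?thesis ..
qed

text \<open>All worlds above \<open>w\<close> outside \<open>subst \<sigma> E\<close> acquire the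
  single realized type \<open>t\<close>, and those inside keep their realized types; this is what
  \<open>subst_E_iff\<close> asks for.\<close>

lemma update_root_type:
  assumes \<sigma>: "\<sigma> \<in> updates" and fl: "flat \<sigma> w"
    and t: "root_type (types_above \<sigma> w) (false_pars w) t"
  shows "subst (update t \<sigma>) E \<in> w"
proof -
  let ?\<rho> = "types_above \<sigma> w" and ?\<tau> = "update t \<sigma>"
  have w: "prime_theory w" using fl by (simp add: flat_def)
  \<comment> \<open>Being the type of a world, \<open>t\<close> respects falsum, conjunction and
    disjunction.\<close>
  obtain u where u: "prime_theory u" "t = type_at \<Phi> \<theta> u"
    using t by (auto simp: root_type_def realized_def)
  have iff: "subst ?\<tau> D \<in> v \<longleftrightarrow> D \<in> t"
    if "D \<in> \<Phi>" "prime_theory v" "w \<subseteq> v" "subst \<sigma> E \<notin> v" for D v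
    using that
  proof (induction D arbitrary: v)
    case (Atom x)
    note v = Atom(2-4)
    have "x \<in> var \<union> par" using Atom Phi_lang by (auto simp: lang_def)
    show ?case
    proof (cases "x \<in> var")
      case True
      \<comment> \<open>If \<open>Atom x\<close> is in \<open>t\<close>, the implication assigned to
        \<open>x\<close> holds at \<open>v\<close>, since \<open>t\<close> is contained in every
        type above \<open>w\<close>. Otherwise the conjunction fails because
        \<open>subst \<sigma> E\<close> does.\<close>
      have "\<sigma> x \<in> v'" if "Atom x \<in> t" "prime_theory v'" "v \<subseteq> v'" "subst \<sigma> E \<in> v'" for v'
      proof -
        have "type_at \<Phi> \<sigma> v' \<in> ?\<rho>" using that v by (auto simp: types_above_def)
        with t that(1) have "Atom x \<in> type_at \<Phi> \<sigma> v'" by (auto simp: root_type_def)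
        then show ?thesis by (simp add: type_at_def)
      qed
      with True v show ?thesis by (auto simp: update_def)
    next
      case False
      with \<open>x \<in> var \<union> par\<close> have "x \<in> par" by blast
      with False t flat_upward(3)[OF fl v] show ?thesis
        by (auto simp: root_type_def update_def false_pars_def)
    qed
  next
    case Bot
    then show ?case using u by (simp add: type_at_def)
  next
    case (Conj D1 D2)
    then show ?case using u Conj_Phi[of D1 D2] by (simp add: type_at_def)
  next
    case (Disj D1 D2)
    then show ?case using u Disj_Phi[of D1 D2] by (simp add: type_at_def)
  next
    case (Impl D1 D2)
    note v = \<open>prime_theory v\<close> \<open>w \<subseteq> v\<close> \<open>subst \<sigma> E \<notin> v\<close>
    have D: "D1 \<in> \<Phi>" "D2 \<in> \<Phi>" using Impl_Phi[OF Impl.prems(1)] by auto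
    have IH: "subst ?\<tau> D1 \<in> v' \<longleftrightarrow> D1 \<in> t" "subst ?\<tau> D2 \<in> v' \<longleftrightarrow> D2 \<in> t"
      if "prime_theory v'" "v \<subseteq> v'" "subst \<sigma> E \<notin> v'" for v'
      using Impl.IH[of v'] that D v by auto
    have "subst ?\<tau> (D1 \<^bold>\<rightarrow> D2) \<in> v \<longleftrightarrow>
        (\<forall>v'. prime_theory v' \<longrightarrow> v \<subseteq> v' \<longrightarrow> subst ?\<tau> D1 \<in> v' \<longrightarrow> subst ?\<tau> D2 \<in> v')"
      using v(1) by simp
    \<comment> \<open>Split the larger worlds by \<open>subst \<sigma> E\<close>. Outside it, where
      \<open>v\<close> itself lies, the induction hypothesis reduces the claim to membership in
      \<open>t\<close>.\<close>
    also have "\<dots> \<longleftrightarrow> (\<forall>v'. prime_theory v' \<longrightarrow> v \<subseteq> v' \<longrightarrow> subst \<sigma> E \<in> v' \<longrightarrow>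
        subst ?\<tau> D1 \<in> v' \<longrightarrow> subst ?\<tau> D2 \<in> v') \<and> (D1 \<in> t \<longrightarrow> D2 \<in> t)"
      using v IH by blast
    also have "(\<forall>v'. prime_theory v' \<longrightarrow> v \<subseteq> v' \<longrightarrow> subst \<sigma> E \<in> v' \<longrightarrow>
        subst ?\<tau> D1 \<in> v' \<longrightarrow> subst ?\<tau> D2 \<in> v') \<longleftrightarrow> (\<forall>s\<in>types_above \<sigma> v. D1 \<^bold>\<rightarrow> D2 \<in> s)"
      unfolding types_above_Impl[OF v(1) Impl.prems(1)]
      using subst_update[OF \<sigma>] D Phi_lang by blast
    also have "types_above \<sigma> v = ?\<rho>" by (rule flat_upward(2)[OF fl v])
    finally show ?case using t Impl.prems(1) by (simp add: root_type_def)
  qed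
  show ?thesis
    unfolding subst_E_iff[OF w]
  proof (intro allI impI)
    fix v assume v: "prime_theory v" "w \<subseteq> v"
    show "type_at \<Phi> ?\<tau> v \<in> realized"
    proof (cases "subst \<sigma> E \<in> v")
      case True
      then show ?thesis using subst_E_iff[OF v(1), of \<sigma>] type_at_update[OF \<sigma> v(1)] v(1) by auto
    next
      case False
      have "type_at \<Phi> ?\<tau> v = t"
        using iff[OF _ v False] u(2) by (auto simp: type_at_def)
      then show ?thesis using t by (simp add: root_type_def)
    qed
  qed
qed

section \<open>Raising the minimal rank\<close>

definition rank_ge :: "nat \<Rightarrow> ('a \<Rightarrow> 'a form) \<Rightarrow> bool" where
  "rank_ge k \<sigma> \<longleftrightarrow> (\<forall>w. prime_theory w \<longrightarrow> C \<in> w \<longrightarrow> subst \<sigma> E \<notin> w \<longrightarrow> k \<le> rank \<sigma> w)"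

text \<open>Larger worlds outside \<open>subst \<sigma> E\<close> still contain \<open>C\<close>, so
  their rank is at least \<open>k\<close> and \<open>rank_eqD\<close> applies.\<close>

lemma flat_minimal_rank:
  assumes "rank_ge k \<sigma>" "prime_theory w" "C \<in> w" "subst \<sigma> E \<notin> w" "rank \<sigma> w = k"
  shows "flat \<sigma> w"
  unfolding flat_def
proof (intro HOL.conjI allI impI)
  fix v assume "prime_theory v" "w \<subseteq> v" "subst \<sigma> E \<notin> v"
  with assms have "rank \<sigma> w \<le> rank \<sigma> v" by (auto simp: rank_ge_def)
  with \<open>w \<subseteq> v\<close> show "types_above \<sigma> v = types_above \<sigma> w" "false_pars v = false_pars w"
    by (rule rank_eqD)+
qed (use assms in auto)

text \<open>Performs one update for each type in \<open>\<T>\<close>, never losing what earlier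
  updates achieved.\<close>

lemma rank_ge_round:
  assumes "\<sigma> \<in> updates" "rank_ge k \<sigma>" "finite \<T>"
  shows "\<exists>\<tau>\<in>updates. rank_ge k \<tau> \<and>
    (\<forall>w. prime_theory w \<longrightarrow> C \<in> w \<longrightarrow> subst \<tau> E \<notin> w \<longrightarrow> rank \<tau> w = k \<longrightarrow>
      (\<forall>t\<in>\<T>. \<not> root_type (types_above \<tau> w) (false_pars w) t))"
  using assms(3)
proof induction
  case empty
  then show ?case using assms by auto
next
  case (insert t \<T>)
  then obtain \<tau> where \<tau>: "\<tau> \<in> updates" "rank_ge k \<tau>"
    and old: "\<And>w t. prime_theory w \<Longrightarrow> C \<in> w \<Longrightarrow> subst \<tau> E \<notin> w \<Longrightarrow> rank \<tau> w = k \<Longrightarrow> t \<in> \<T> \<Longrightarrow>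
      \<not> root_type (types_above \<tau> w) (false_pars w) t" by blast
  let ?\<tau> = "update t \<tau>"
  have "rank_ge k ?\<tau>"
    using \<tau> rank_update[OF \<tau>(1)] subst_update_E[OF \<tau>(1)]
    unfolding rank_ge_def by (meson order_trans)
  moreover have "\<not> root_type (types_above ?\<tau> w) (false_pars w) t'"
    if w: "prime_theory w" "C \<in> w" "subst ?\<tau> E \<notin> w" "rank ?\<tau> w = k" and t': "t' \<in> insert t \<T>"
    for w t'
  proof -
    \<comment> \<open>A world of rank \<open>k\<close> still outside after the update was already
      outside, with the same rank and the same types above. So earlier exclusions persist, and a
      root type \<open>t\<close> would have moved it inside.\<close>
    have w': "subst \<tau> E \<notin> w" using w subst_update_E \<tau>(1) by blast
    then have k: "rank \<tau> w = k"
      using \<tau>(2) w rank_update[OF \<tau>(1), of w t] by (auto simp: rank_ge_def intro: antisym)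
    have eq: "types_above \<tau> w = types_above ?\<tau> w"
      using k w(4) by (intro card_seteq types_above_update \<tau>) (auto simp: rank_def)
    show ?thesis
    proof (cases "t' = t")
      case True
      then show ?thesis
        using update_root_type[OF \<tau>(1) flat_minimal_rank[OF \<tau>(2) w(1,2) w' k]] w(3) eq by auto
    next
      case False
      then show ?thesis using old[OF w(1,2) w' k] t' eq by auto
    qed
  qed
  ultimately show ?case using \<tau>(1) updates.intros(2) by (intro bexI[of _ ?\<tau>]) auto
qed

text \<open>After a round through \<open>Pow \<Phi>\<close>, a remaining world of rank
  \<open>k\<close> would be flat and so have a root type, which the round excluded.\<close>

lemma rank_ge_exists: "\<exists>\<sigma>\<in>updates. rank_ge k \<sigma>"
proof (induction k)
  case 0
  show ?case using updates.intros(1) by (auto simp: rank_ge_def)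
next
  case (Suc k)
  then obtain \<sigma> where "\<sigma> \<in> updates" "rank_ge k \<sigma>" by blast
  from rank_ge_round[OF this, of "Pow \<Phi>"] finite_Phi
  obtain \<tau> where \<tau>: "\<tau> \<in> updates" "rank_ge k \<tau>"
    and none: "\<And>w t. prime_theory w \<Longrightarrow> C \<in> w \<Longrightarrow> subst \<tau> E \<notin> w \<Longrightarrow> rank \<tau> w = k \<Longrightarrow> t \<subseteq> \<Phi> \<Longrightarrow>
      \<not> root_type (types_above \<tau> w) (false_pars w) t" by auto
  have "Suc k \<le> rank \<tau> w" if w: "prime_theory w" "C \<in> w" "subst \<tau> E \<notin> w" for w
  proof -
    have "rank \<tau> w \<noteq> k"
    proof
      assume k: "rank \<tau> w = k"
      obtain t where t: "root_type (types_above \<tau> w) (false_pars w) t"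
        using root_type_exists[OF \<tau>(1) flat_minimal_rank[OF \<tau>(2) w k]] by blast
      then have "t \<subseteq> \<Phi>" by (auto simp: root_type_def realized_def type_at_def)
      with none w k t show False by blast
    qed
    with \<tau>(2) w show ?thesis by (auto simp: rank_ge_def le_less)
  qed
  with \<tau>(1) show ?case by (auto simp: rank_ge_def)
qed

lemma projective_unifier: "\<exists>\<sigma>. projective var par E \<sigma> \<and> {} \<turnstile> subst \<sigma> E \<^bold>\<leftrightarrow> C"
proof -
  \<comment> \<open>This bound is one more than \<open>rank_le\<close> permits, so no world
    containing \<open>C\<close> is left outside.\<close>
  obtain \<sigma> where \<sigma>: "\<sigma> \<in> updates"
    "rank_ge (Suc (card par * Suc (card (Pow \<Phi>)) + card (Pow \<Phi>))) \<sigma>"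
    using rank_ge_exists by blast
  have "subst \<sigma> E \<in> w" if "prime_theory w" "C \<in> w" for w
    using \<sigma>(2) that rank_le[of \<sigma> w] by (auto simp: rank_ge_def not_less_eq_eq[symmetric])
  then have "{C} \<turnstile> subst \<sigma> E" by (simp add: ipc_iff_prime)
  moreover have "{subst \<sigma> E} \<turnstile> C"
    using subst_ipc[OF E_entails_C, of \<sigma>] subst_par[OF updates_substitution[OF \<sigma>(1)] C_par]
    by simp
  ultimately have "{} \<turnstile> subst \<sigma> E \<^bold>\<leftrightarrow> C" by (simp add: conjI ipc_Impl_iff)
  then show ?thesis using updates_projective[OF \<sigma>(1)] by blast
qed

end

section \<open>Projective approximation\<close>

primrec subformulas :: "'a form \<Rightarrow> 'a form set" where
  "subformulas (Atom a) = {Atom a}"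
| "subformulas \<^bold>\<bottom> = {\<^bold>\<bottom>}"
| "subformulas (A \<^bold>\<and> B) = insert (A \<^bold>\<and> B) (subformulas A \<union> subformulas B)"
| "subformulas (A \<^bold>\<or> B) = insert (A \<^bold>\<or> B) (subformulas A \<union> subformulas B)"
| "subformulas (A \<^bold>\<rightarrow> B) = insert (A \<^bold>\<rightarrow> B) (subformulas A \<union> subformulas B)"

lemma subformulas_refl [simp]: "A \<in> subformulas A"
  by (cases A) auto

lemma finite_subformulas [simp]: "finite (subformulas A)"
  by (induction A) auto

lemma atoms_subformulas: "D \<in> subformulas A \<Longrightarrow> atoms D \<subseteq> atoms A"
  by (induction A) auto

lemma subformulas_trans: "D \<in> subformulas A \<Longrightarrow> subformulas D \<subseteq> subformulas A"
  by (induction A) auto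

lemma projective_approximation:
  assumes "finite var" "finite par" "var \<inter> par = {}" and A: "A \<in> lang var par"
    and \<theta>: "substitution var par \<theta>" and C: "atoms C \<subseteq> par" and CA: "{C} \<turnstile> subst \<theta> A"
  obtains E \<sigma> where "E \<in> lang var par" "projective var par E \<sigma>" "{} \<turnstile> subst \<sigma> E \<^bold>\<leftrightarrow> C"
    "{E} \<turnstile> A" "{C} \<turnstile> subst \<theta> E"
proof -
  define \<Phi> where "\<Phi> = subformulas A \<union> subformulas C \<union> Atom ` (var \<union> par)"
  have fin: "finite \<Phi>" using assms(1,2) by (simp add: \<Phi>_def)
  have lang: "\<Phi> \<subseteq> lang var par"
    using A C atoms_subformulas unfolding \<Phi>_def lang_def by fastforce
  have closed: "subformulas D \<subseteq> \<Phi>" if "D \<in> \<Phi>" for D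
    using that subformulas_trans unfolding \<Phi>_def by fastforce
  show thesis
  proof (rule types_definable[OF fin lang,
        where R = "{type_at \<Phi> \<theta> u | u. prime_theory u \<and> C \<in> u}"])
    fix E
    assume E: "E \<in> lang var par"
      "\<And>\<sigma> w. prime_theory w \<Longrightarrow> subst \<sigma> E \<in> w \<longleftrightarrow> (\<forall>v. prime_theory v \<longrightarrow> w \<subseteq> v \<longrightarrow>
        type_at \<Phi> \<sigma> v \<in> {type_at \<Phi> \<theta> u | u. prime_theory u \<and> C \<in> u})"
    interpret relative_unifier var par C \<theta> \<Phi> E
    proof
      show "C \<in> \<Phi>" "Atom ` (var \<union> par) \<subseteq> \<Phi>" by (auto simp: \<Phi>_def)
      show "D \<in> \<Phi> \<and> D' \<in> \<Phi>" if "D \<^bold>\<and> D' \<in> \<Phi>" for D D' using closed[OF that] by auto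
      show "D \<in> \<Phi> \<and> D' \<in> \<Phi>" if "D \<^bold>\<or> D' \<in> \<Phi>" for D D' using closed[OF that] by auto
      show "D \<in> \<Phi> \<and> D' \<in> \<Phi>" if "D \<^bold>\<rightarrow> D' \<in> \<Phi>" for D D' using closed[OF that] by auto
    qed (fact assms fin lang E)+
    have "A \<in> \<Phi>" by (simp add: \<Phi>_def)
    then have "{E} \<turnstile> A" using CA by (rule E_entails)
    then show thesis using that E(1) projective_unifier subst_theta_E by blast
  qed
qed

section \<open>The equivalence of preservativity and admissibility\<close>

lemma ipc_trans: "{A} \<turnstile> B \<Longrightarrow> {B} \<turnstile> D \<Longrightarrow> {A} \<turnstile> D"
  by (auto simp: ipc_iff_prime)

text \<open>From \<open>w\<close> upwards each atom of the language agrees with its image, so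
  \<open>\<sigma>\<close> can be compared with the identity \<open>Atom\<close>.\<close>

lemma projective_subst:
  assumes "projective var par E \<sigma>" "D \<in> lang var par" "prime_theory w" "E \<in> w"
  shows "subst \<sigma> D \<in> w \<longleftrightarrow> D \<in> w"
proof -
  have "subst \<sigma> D \<in> w \<longleftrightarrow> subst Atom D \<in> w"
  proof (rule subst_cong_prime[OF assms(3)])
    fix v a assume v: "prime_theory v" "w \<subseteq> v" and "a \<in> atoms D"
    then have "{E} \<turnstile> Atom a \<^bold>\<leftrightarrow> \<sigma> a"
      using assms(1,2) by (auto simp: projective_def lang_def)
    then have "Atom a \<^bold>\<leftrightarrow> \<sigma> a \<in> v"
      using v assms(4) by (auto simp only: ipc_iff_prime)
    then show "\<sigma> a \<in> v \<longleftrightarrow> Atom a \<in> v"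
      using v(1) by auto
  qed
  then show ?thesis by simp
qed

theorem theorem4p17:
  fixes var par :: "'a set" and A B :: "'a form"
  assumes "finite var" and "finite par" and "var \<inter> par = {}"
    and "A \<in> lang var par" and "B \<in> lang var par"
  shows "preserves (down var par (NNIL_par par)) A B \<longleftrightarrow>
         admissible var par (NNIL_par par) A B"
proof
  assume pres: "preserves (down var par (NNIL_par par)) A B"
  show "admissible var par (NNIL_par par) A B"
    unfolding admissible_def
  proof (intro allI ballI impI)
    fix \<theta> C
    assume \<theta>: "substitution var par \<theta>" and C: "C \<in> NNIL_par par"
      and "{} \<turnstile> subst \<theta> (C \<^bold>\<rightarrow> A)"
    moreover have "atoms C \<subseteq> par" using C by (simp add: NNIL_par_def)
    moreover from this have fix_C: "subst \<theta> C = C"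
      using \<theta> by (intro subst_fixed) (auto simp: substitution_def)
    ultimately obtain E \<sigma> where E: "E \<in> lang var par" "projective var par E \<sigma>"
      "{} \<turnstile> subst \<sigma> E \<^bold>\<leftrightarrow> C" "{E} \<turnstile> A" "{C} \<turnstile> subst \<theta> E"
      using projective_approximation[OF assms(1-4) \<theta>, of C] by (auto simp: ipc_Impl_iff)
    then have "E \<in> down var par (NNIL_par par)" using C by (auto simp: down_def)
    with pres E(4) have "{E} \<turnstile> B" by (auto simp: preserves_def ipc_Impl_iff)
    \<comment> \<open>Derivability is closed under \<open>\<theta>\<close>; composing with
      \<open>{C} \<turnstile> subst \<theta> E\<close> yields the claim.\<close>
    then have "{subst \<theta> E} \<turnstile> subst \<theta> B" using subst_ipc[of "{E}"] by fastforce
    with E(5) show "{} \<turnstile> subst \<theta> (C \<^bold>\<rightarrow> B)"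
      using ipc_trans by (auto simp: ipc_Impl_iff fix_C)
  qed
next
  assume adm: "admissible var par (NNIL_par par) A B"
  show "preserves (down var par (NNIL_par par)) A B"
    unfolding preserves_def
  proof (intro ballI impI)
    fix E assume "E \<in> down var par (NNIL_par par)" and "{} \<turnstile> E \<^bold>\<rightarrow> A"
    then obtain \<sigma> C where E: "E \<in> lang var par" "projective var par E \<sigma>" "C \<in> NNIL_par par"
      "{} \<turnstile> subst \<sigma> E \<^bold>\<leftrightarrow> C" "{E} \<turnstile> A" by (auto simp: down_def ipc_Impl_iff)
    have \<sigma>: "substitution var par \<sigma>" using E(2) by (simp add: projective_def)
    have fix_C: "subst \<sigma> C = C"
      using \<sigma> E(3) by (intro subst_fixed) (auto simp: substitution_def NNIL_par_def)
    have CE: "{C} \<turnstile> subst \<sigma> E" "{subst \<sigma> E} \<turnstile> C"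
      using E(4) conjE1 conjE2 ipc_Impl_iff by blast+
    \<comment> \<open>Admissibility is instantiated with the projective substitution itself and with
      the parameter formula \<open>C\<close> equivalent to \<open>subst \<sigma> E\<close>.\<close>
    have "{subst \<sigma> E} \<turnstile> subst \<sigma> A" using subst_ipc[OF E(5), of \<sigma>] by simp
    then have "{} \<turnstile> subst \<sigma> (C \<^bold>\<rightarrow> A)" using CE(1) ipc_trans by (auto simp: ipc_Impl_iff fix_C)
    with adm \<sigma> E(3) have "{} \<turnstile> subst \<sigma> (C \<^bold>\<rightarrow> B)" by (auto simp: admissible_def)
    then have "{subst \<sigma> E} \<turnstile> subst \<sigma> B"
      using CE(2) ipc_trans by (auto simp: ipc_Impl_iff fix_C)
    \<comment> \<open>At worlds containing \<open>E\<close>, projectivity identifies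
      \<open>E\<close> and \<open>B\<close> with their images under \<open>\<sigma>\<close>.\<close>
    then have "{E} \<turnstile> B"
      using projective_subst[OF E(2)] E(1) assms(5) by (auto simp: ipc_iff_prime)
    then show "{} \<turnstile> E \<^bold>\<rightarrow> B" by (simp add: ipc_Impl_iff)
  qed
qed

end
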